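(* Let $n\ge4$. Then $F$ is a subgroup of $E$. Moreover, $$D^{2^{n-2}}<F\le E<D ,$$ where $<$ denotes a proper subgroup.
   Context: Let $\alpha=e^{2\pi i/2^n}$. For $\rho,\sigma\in\mathbf{Z}[\alpha]$, $\rho\equiv\sigma\pmod 2$ means $\rho-\sigma\in 2\mathbf{Z}[\alpha]$. For an integer $j$ put $d_j=1+\alpha^j+\alpha^{-j}$. Let $D$ be the subgroup of the unit group of $\mathbf{Z}[\alpha]$ generated by $d_1,d_3,\dots,d_{2^{n-1}-3}$ (it is the internal direct product of the infinite cyclic groups $\langle d_{2l+1}\rangle$, $0\le l\le 2^{n-2}-2$), and let $D^m=\{d^m\mid d\in D\}$. Put $E=\{\lambda\in D\mid \lambda\equiv 1\pmod 2\}$. For $k\in\{0,1,\dots,n-3\}$ let $A_k=\{1,3,5,\dots,2^{n-2-k}-1\}$ (all odd integers from $1$ to $2^{n-2-k}-1$). For $2l+1\in A_0\setminus\{1\}$ (when $k=0$) or $2l+1\in A_k$ (when $1\le k\le n-3$) put $q(k,2l+1)=d_{2l+1}^{-1}d_{2^{n-1-k}-(2l+1)}$. Put $F_0=\prod_{2l+1\in A_0\setminus\{1\}}\langle q(0,2l+1)\rangle$, $F_k=\prod_{2l+1\in A_k}\langle q(k,2l+1)^{2^k}\rangle$ for $1\le k\le n-3$, and $F=\langle d_1^{2^{n-2}}\rangle\times\prod_{k=0}^{n-3}F_k$ (internal direct products). *)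

theory Defs
  imports
    Complex_Main
    "HOL-Computational_Algebra.Polynomial"
    "HOL-Algebra.Generated_Groups"
    "HOL-Algebra.Ring"
begin

definition alpha :: "nat \<Rightarrow> complex" where
  "alpha n = exp (2 * complex_of_real pi * \<i> / 2 ^ n)"

definition Z_alpha :: "nat \<Rightarrow> complex set" where
  "Z_alpha n = {poly (map_poly of_int p) (alpha n) | p :: int poly. True}"

definition Z_alpha_ring :: "nat \<Rightarrow> complex ring" where
  "Z_alpha_ring n =
     \<lparr>carrier = Z_alpha n, mult = (*), one = 1, zero = 0, add = (+)\<rparr>"

abbreviation unit_grp :: "nat \<Rightarrow> complex monoid" where
  "unit_grp n \<equiv> units_of (Z_alpha_ring n)"

definition cong2 :: "nat \<Rightarrow> complex \<Rightarrow> complex \<Rightarrow> bool" where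
  "cong2 n \<rho> \<sigma> \<longleftrightarrow> (\<exists>\<tau>\<in>Z_alpha n. \<rho> - \<sigma> = 2 * \<tau>)"

definition d :: "nat \<Rightarrow> int \<Rightarrow> complex" where
  "d n j = 1 + alpha n powi j + alpha n powi (- j)"

definition grp_D :: "nat \<Rightarrow> complex set" where
  "grp_D n = generate (unit_grp n) (d n ` {j. odd j \<and> 1 \<le> j \<and> j \<le> 2 ^ (n - 1) - 3})"

definition powers :: "complex set \<Rightarrow> nat \<Rightarrow> complex set" where
  "powers H m = (\<lambda>x. x ^ m) ` H"

definition grp_E :: "nat \<Rightarrow> complex set" where
  "grp_E n = {x \<in> grp_D n. cong2 n x 1}"

definition idx_A :: "nat \<Rightarrow> nat \<Rightarrow> int set" where
  "idx_A n k = {j. odd j \<and> 1 \<le> j \<and> j \<le> 2 ^ (n - 2 - k) - 1}"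

definition q :: "nat \<Rightarrow> nat \<Rightarrow> int \<Rightarrow> complex" where
  "q n k j = inverse (d n j) * d n (2 ^ (n - 1 - k) - j)"

definition cyc :: "nat \<Rightarrow> complex \<Rightarrow> complex set" where
  "cyc n x = generate (unit_grp n) {x}"

text \<open>
  The internal product of a finite family of subgroups of the abelian group of units.
  Directness (uniqueness of the factors) is a property of the family, which does not affect
  the resulting set.
\<close>

definition int_prod :: "('i \<Rightarrow> complex set) \<Rightarrow> 'i set \<Rightarrow> complex set" where
  "int_prod H I = {(\<Prod>i\<in>I. x i) | x. \<forall>i\<in>I. x i \<in> H i}"

definition part_F :: "nat \<Rightarrow> nat \<Rightarrow> complex set" where
  "part_F n k =
     (if k = 0 then int_prod (\<lambda>j. cyc n (q n 0 j)) (idx_A n 0 - {1})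
      else int_prod (\<lambda>j. cyc n (q n k j ^ (2 ^ k))) (idx_A n k))"

definition grp_F :: "nat \<Rightarrow> complex set" where
  "grp_F n =
     cyc n (d n 1 ^ (2 ^ (n - 2))) <#>\<^bsub>unit_grp n\<^esub> int_prod (part_F n) {0..n - 3}"

definition subgroup_of :: "('a, 'b) monoid_scheme \<Rightarrow> 'a set \<Rightarrow> 'a set \<Rightarrow> bool" where
  "subgroup_of G H K \<longleftrightarrow> subgroup K G \<and> subgroup H (G\<lparr>carrier := K\<rparr>)"

definition proper_subgroup_of :: "('a, 'b) monoid_scheme \<Rightarrow> 'a set \<Rightarrow> 'a set \<Rightarrow> bool" where
  "proper_subgroup_of G H K \<longleftrightarrow> subgroup_of G H K \<and> H \<noteq> K"

end

theory Submission
  imports Defs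
begin

text \<open>
  Write \<open>\<alpha>\<close> for the primitive root of unity of order \<open>2^n\<close>. All elements of \<open>D\<close> are products of
  the units \<open>d\<^sub>j = 1 + \<alpha>^j + \<alpha>^(-j)\<close>, and three properties of these carry the inclusions
  (\<open>d_square_cong\<close>, \<open>d_reflect\<close>, \<open>d_unit\<close>): modulo 2 squaring is a ring endomorphism, so it doubles
  the index; since \<open>\<alpha>^(2^(n-1)) = -1\<close>, the reflection \<open>j \<mapsto> 2^(n-1) - j\<close> sends \<open>d\<^sub>j\<close> to \<open>2 - d\<^sub>j\<close> and so fixes
  its class modulo 2; and \<open>d\<^sub>j\<close> is invertible for odd \<open>j\<close>, because 3 is invertible modulo \<open>2^n\<close>.

  The element \<open>q(k,j)\<close> is the quotient of \<open>d\<close> at \<open>2^(n-1-k) - j\<close> by \<open>d\<close> at \<open>j\<close>. Multiplying both indices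
  by \<open>2^k\<close> turns the reflection at \<open>2^(n-1-k)\<close> into the one at \<open>2^(n-1)\<close>; hence the \<open>2^k\<close>-th power of
  \<open>q(k,j)\<close> is 1 modulo 2, which gives \<open>F \<subseteq> E\<close>. Conversely the relations \<open>q(k,j)^(2^k) \<in> F\<close> say that, in
  \<open>D\<close> modulo \<open>F\<close>, the \<open>2^(n-2)\<close>-th powers of the \<open>d\<^sub>j\<close> do not change when an index between two
  consecutive powers of 2 is reflected at the larger one. The reflected index is smaller, so descent
  reaches \<open>d\<^sub>1\<close>, whose \<open>2^(n-2)\<close>-th power generates the first factor of \<open>F\<close>; this proves that the
  \<open>2^(n-2)\<close>-th powers of \<open>D\<close> lie in \<open>F\<close> (\<open>d_power_in_F\<close>).

  Both strict inclusions rest on the irreducibility of \<open>x^(2^(n-1)) + 1\<close>, that is, on the fact that an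
  integer polynomial vanishing at \<open>\<alpha>\<close> is divisible by it. Evaluation at 1 shows that 2 is not a unit of
  \<open>\<int>[\<alpha>]\<close>. If \<open>d\<^sub>1\<close> were in \<open>E\<close>, repeated squaring would put \<open>\<surd>2\<close>, the value of \<open>\<alpha>^j + \<alpha>^(-j)\<close> at
  \<open>j = 2^(n-3)\<close>, into \<open>2\<int>[\<alpha>]\<close>, and then \<open>1/2\<close> would lie in \<open>\<int>[\<alpha>]\<close> (\<open>d_1_notin_E\<close>). Evaluation at another
  root \<open>\<beta>\<close> of the polynomial is Galois conjugation. The element \<open>q(0,3) = (2 - d\<^sub>3) / d\<^sub>3\<close> of \<open>F\<close> is
  conjugated, by taking \<open>\<beta>\<close> with \<open>\<beta>^3 = \<alpha>\<close>, to \<open>(1 - c) / (1 + c)\<close> with \<open>c = 2 cos (2\<pi>/2^n) > 1\<close>, a negative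
  number, whereas elements of \<open>D\<close> and all their conjugates are real, so that squares in \<open>D\<close> stay
  nonnegative (\<open>q_not_square\<close>).
\<close>

section \<open>Evaluation of integer polynomials\<close>

abbreviation ev :: "int poly \<Rightarrow> complex \<Rightarrow> complex" where
  "ev p z \<equiv> poly (map_poly of_int p) z"

lemma ev_pCons: "ev (pCons a p) z = of_int a + z * ev p z"
  by (simp add: map_poly_pCons)

lemma ev_add: "ev (p + r) z = ev p z + ev r z"
proof (induction p r rule: poly_induct2)
  case 0 show ?case by simp
next
  case (pCons a p b r) thus ?case by (simp add: ev_pCons algebra_simps)
qed

lemma ev_smult: "ev (smult c p) z = of_int c * ev p z"
  by (induction p) (simp_all add: ev_pCons algebra_simps)

lemma ev_diff: "ev (p - r) z = ev p z - ev r z"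
  using ev_add[of "p - r" r z] by simp

lemma ev_mult: "ev (p * r) z = ev p z * ev r z"
  by (induction p) (simp_all add: ev_pCons ev_add ev_smult algebra_simps)

lemma ev_1: "ev 1 z = 1"
  by (simp add: map_poly_1')

lemma ev_monom: "ev (monom 1 k) z = z ^ k"
  by (simp add: map_poly_monom poly_monom)

lemma ev_power: "ev (p ^ k) z = ev p z ^ k"
  by (induction k) (simp_all add: ev_mult ev_1)

lemma ev_pcompose: "ev (pcompose p r) z = ev p (ev r z)"
  by (induction p) (simp_all add: pcompose_pCons ev_pCons ev_add ev_mult)

lemma ev_cnj: "ev p (cnj z) = cnj (ev p z)"
  by (induction p) (simp_all add: ev_pCons)

lemmas ev_simps = ev_pCons ev_add ev_smult ev_diff ev_mult ev_1 ev_monom ev_power ev_pcompose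

section \<open>The minimal polynomial of a primitive root of unity of two-power order\<close>

text \<open>
  If the prime does not divide the constant coefficient of \<open>h\<close>, the low coefficients of \<open>f\<close> are divisible
  by it one after the other: in the coefficient of \<open>f * h\<close> at \<open>i\<close> all summands except \<open>f\<^sub>i h\<^sub>0\<close> are
  already known to be divisible. As the leading coefficient of \<open>f\<close> is not divisible, \<open>f\<close> carries the
  full degree.
\<close>
lemma eisenstein_constant_factor:
  fixes p :: int and f h :: "int poly"
  assumes p: "prime p"
    and low: "\<And>i. i < degree (f * h) \<Longrightarrow> p dvd coeff (f * h) i"
    and lead: "\<not> p dvd lead_coeff (f * h)"
    and h0: "\<not> p dvd coeff h 0"
  shows "degree h = 0"
proof -
  have nz: "f \<noteq> 0" "h \<noteq> 0" using lead by auto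
  have "p dvd coeff f i" if "i < degree (f * h)" for i
    using that
  proof (induction i rule: less_induct)
    case (less i)
    have "coeff (f * h) i = (\<Sum>j\<le>i. coeff f j * coeff h (i - j))"
      by (simp add: coeff_mult)
    also have "\<dots> = (\<Sum>j<i. coeff f j * coeff h (i - j)) + coeff f i * coeff h 0"
      by (simp add: lessThan_Suc_atMost[symmetric])
    finally have "coeff f i * coeff h 0
        = coeff (f * h) i - (\<Sum>j<i. coeff f j * coeff h (i - j))" by simp
    moreover have "p dvd (\<Sum>j<i. coeff f j * coeff h (i - j))"
      using less by (intro dvd_sum dvd_mult2) auto
    ultimately have "p dvd coeff f i * coeff h 0" using low[OF less.prems] by simp
    thus ?case using h0 p by (simp add: prime_dvd_mult_iff)
  qed
  moreover have "\<not> p dvd lead_coeff f"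
    using lead by (auto simp: lead_coeff_mult)
  ultimately have "\<not> degree f < degree (f * h)" by blast
  thus ?thesis using nz by (simp add: degree_mult_eq)
qed

text \<open>
  Eisenstein's criterion: the prime divides at most one of the two constant coefficients.
\<close>
lemma eisenstein:
  fixes p :: int and f h :: "int poly"
  assumes p: "prime p"
    and low: "\<And>i. i < degree (f * h) \<Longrightarrow> p dvd coeff (f * h) i"
    and lead: "\<not> p dvd lead_coeff (f * h)"
    and const: "\<not> p ^ 2 dvd coeff (f * h) 0"
  shows "degree f = 0 \<or> degree h = 0"
proof -
  have "\<not> (p dvd coeff f 0 \<and> p dvd coeff h 0)"
    using const by (auto simp: coeff_mult_0 power2_eq_square intro: mult_dvd_mono)
  thus ?thesis
    using eisenstein_constant_factor[of p f h] eisenstein_constant_factor[of p h f] assms by (auto simp: mult.commute)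
qed

text \<open>
  Gauss's lemma for minimal polynomials. A primitive integer polynomial \<open>f\<close> of least degree vanishing
  at \<open>z\<close> divides a multiple \<open>a * u\<close> of every \<open>u\<close> with this root, by pseudo-division, and since
  contents are multiplicative the factor \<open>a\<close> can be cancelled. So \<open>f\<close> divides \<open>P\<close>, and
  irreducibility makes the cofactor a unit.
\<close>
lemma monic_irreducible_dvd:
  fixes P g :: "int poly" and z :: complex
  assumes monic: "lead_coeff P = 1"
    and irred: "\<And>f h. P = f * h \<Longrightarrow> degree f = 0 \<or> degree h = 0"
    and Pz: "ev P z = 0" and gz: "ev g z = 0"
  shows "P dvd g"
proof -
  define A where "A = {f :: int poly. f \<noteq> 0 \<and> ev f z = 0}"
  have PA: "P \<in> A" using monic Pz by (auto simp: A_def)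
  obtain f0 where f0: "f0 \<in> A" "\<And>f. f \<in> A \<Longrightarrow> degree f0 \<le> degree f"
    using arg_min_natI[of "\<lambda>f. f \<in> A" P degree] arg_min_nat_le[of "\<lambda>f. f \<in> A" _ degree] PA
    by metis
  define f where "f = primitive_part f0"
  have f0_eq: "f0 = smult (content f0) f" by (simp add: f_def)
  have f0nz: "f0 \<noteq> 0" using f0 by (simp add: A_def)
  have deg_f: "degree f = degree f0" by (simp add: f_def)
  have fnz: "f \<noteq> 0" using f0nz by (simp add: f_def)
  have cf: "content f = 1" using f0nz by (simp add: f_def)
  have "of_int (content f0) * ev f z = 0"
    using f0 f0_eq by (metis (mono_tags, lifting) A_def ev_smult mem_Collect_eq)
  hence fz: "ev f z = 0" using f0nz by simp
  have f_dvd: "f dvd u" if u: "ev u z = 0" for u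
  proof -
    obtain a q where a: "a \<noteq> 0" and eq: "smult a u = f * q + pseudo_mod u f"
      using pseudo_mod(1)[OF fnz, of u] by blast
    have "ev (pseudo_mod u f) z = ev (smult a u - f * q) z" using eq by simp
    hence "ev (pseudo_mod u f) z = 0" by (simp add: ev_diff ev_smult ev_mult u fz)
    moreover have "pseudo_mod u f = 0 \<or> degree (pseudo_mod u f) < degree f"
      using pseudo_mod(2)[OF fnz] .
    ultimately have "pseudo_mod u f = 0"
      using f0(2)[of "pseudo_mod u f"] deg_f unfolding A_def mem_Collect_eq by linarith
    hence eq': "smult a u = f * q" using eq by simp
    have "content q = content (f * q)" by (simp add: content_mult cf)
    also have "\<dots> = normalize a * content u" by (simp add: eq'[symmetric])
    finally have "a dvd content q" by simp
    hence "[:a:] dvd q" by (simp add: const_poly_dvd_iff_dvd_content)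
    then obtain q' where "q = [:a:] * q'" by (rule dvdE)
    hence "smult a u = smult a (f * q')" using eq' by simp
    hence "smult a (u - f * q') = 0" by (simp only: smult_diff_right diff_self)
    hence "u = f * q'" using a by simp
    thus ?thesis by simp
  qed
  obtain h where h: "P = f * h" using f_dvd[OF Pz] by (rule dvdE)
  have "degree f \<noteq> 0"
  proof
    assume "degree f = 0"
    then obtain c where "f = [:c:]" by (rule degree_eq_zeroE)
    thus False using fz fnz by (simp add: ev_pCons)
  qed
  hence "degree h = 0" using irred[OF h] by simp
  then obtain c where c: "h = [:c:]" by (rule degree_eq_zeroE)
  have "lead_coeff f * c = 1" using monic unfolding h lead_coeff_mult by (simp add: c)
  hence "is_unit c" by (metis dvd_triv_right)
  hence "is_unit h" by (simp add: c is_unit_const_poly_iff)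
  hence "P dvd f" unfolding h by (simp add: mult_unit_dvd_iff)
  thus ?thesis using f_dvd[OF gz] by (rule dvd_trans)
qed

text \<open>
  Iterated squaring modulo 2. It gives the evenness of the middle coefficients that Eisenstein's
  criterion needs after the substitution of \<open>x + 1\<close> for \<open>x\<close>.
\<close>
lemma shifted_two_power:
  "\<exists>r :: int poly. [:1, 1:] ^ (2 ^ m) = monom 1 (2 ^ m) + 1 + 2 * r"
proof (induction m)
  case 0
  have "[:1, 1:] ^ (2 ^ 0) = monom (1::int) (2 ^ 0) + 1 + 2 * 0"
    by (simp add: monom_Suc one_pCons monom_0)
  thus ?case by blast
next
  case (Suc m)
  then obtain r :: "int poly" where r: "[:1, 1:] ^ (2 ^ m) = monom 1 (2 ^ m) + 1 + 2 * r" by blast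
  let ?x = "monom (1::int) (2 ^ m)"
  have "[:1, 1::int:] ^ (2 ^ Suc m) = (?x + 1 + 2 * r) ^ 2"
    unfolding r[symmetric] by (simp add: power_mult[symmetric] mult.commute)
  also have "\<dots> = ?x * ?x + 1 + 2 * (?x + 2 * r * (?x + 1) + 2 * r ^ 2)"
    by (simp add: power2_eq_square algebra_simps)
  also have "?x * ?x = monom 1 (2 ^ Suc m)" by (simp add: mult_monom mult_2)
  finally show ?case by blast
qed

lemma pcompose_power: "pcompose (p ^ k) s = pcompose p s ^ k" for p s :: "int poly"
  by (induction k) (simp_all add: pcompose_mult pcompose_1)

lemma two_power_cyclotomic_irreducible:
  fixes f h :: "int poly"
  assumes eq: "monom 1 (2 ^ m) + 1 = f * h"
  shows "degree f = 0 \<or> degree h = 0"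
proof -
  let ?s = "[:1, 1::int:]"
  let ?N = "2 ^ m :: nat"
  let ?F = "pcompose f ?s * pcompose h ?s"
  have F: "?F = ?s ^ ?N + 1"
    by (simp add: pcompose_mult[symmetric] eq[symmetric] pcompose_add pcompose_1
        monom_altdef pcompose_smult pcompose_power pcompose_pCons)
  obtain r where r: "?s ^ ?N = monom 1 ?N + 1 + 2 * r" using shifted_two_power by blast
  have deg_s: "degree (?s ^ ?N) = ?N" by (simp add: degree_power_eq)
  have deg: "degree ?F = ?N" unfolding F by (subst degree_add_eq_left) (simp_all add: deg_s)
  have "degree (pcompose f ?s) = 0 \<or> degree (pcompose h ?s) = 0"
  proof (rule eisenstein[of 2])
    show "prime (2::int)" by simp
    show "2 dvd coeff ?F i" if "i < degree ?F" for i
    proof -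
      have "?F = monom 1 ?N + 2 * (1 + r)" unfolding F r by (simp add: algebra_simps)
      thus ?thesis using that unfolding deg by (simp add: coeff_monom numeral_poly)
    qed
    have "lead_coeff ?F = coeff (?s ^ ?N) ?N" unfolding deg unfolding F by simp
    also have "\<dots> = lead_coeff (?s ^ ?N)" by (simp add: deg_s)
    also have "\<dots> = 1" by (simp add: lead_coeff_power)
    finally show "\<not> 2 dvd lead_coeff ?F" by simp
    show "\<not> 2 ^ 2 dvd coeff ?F 0" unfolding F by (simp add: coeff_0_power)
  qed
  thus ?thesis by (simp add: degree_pcompose)
qed


lemma alpha_power_half: "n \<ge> 1 \<Longrightarrow> alpha n ^ (2 ^ (n - 1)) = - 1"
proof -
  assume "n \<ge> 1"
  then obtain m where n: "n = Suc m" by (cases n) auto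
  have "alpha n ^ (2 ^ (n - 1)) = exp (of_nat (2 ^ m) * (2 * complex_of_real pi * \<i> / 2 ^ n))"
    unfolding alpha_def n by (simp only: exp_of_nat_mult diff_Suc_1)
  also have "of_nat (2 ^ m) * (2 * complex_of_real pi * \<i> / 2 ^ n) = complex_of_real pi * \<i>"
    by (simp add: n)
  finally show ?thesis by simp
qed

lemma minimal_poly_alpha:
  assumes n: "n \<ge> 1" and g: "ev g (alpha n) = 0"
  shows "monom 1 (2 ^ (n - 1)) + 1 dvd g"
proof (rule monic_irreducible_dvd[OF _ two_power_cyclotomic_irreducible _ g])
  have "degree (monom (1::int) (2 ^ (n - 1)) + 1) = 2 ^ (n - 1)"
    by (subst degree_add_eq_left) (simp_all add: degree_monom_eq)
  thus "lead_coeff (monom (1::int) (2 ^ (n - 1)) + 1) = 1" by simp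
  show "ev (monom 1 (2 ^ (n - 1)) + 1) (alpha n) = 0"
    using alpha_power_half[OF n] by (simp add: ev_simps)
qed

text \<open>
  Reduction of \<open>\<int>[\<alpha>]\<close> modulo the prime above 2: the minimal polynomial takes the value 2 at 1.
\<close>
lemma even_at_one_if_root_alpha:
  assumes "n \<ge> 1" "ev g (alpha n) = 0"
  shows "even (poly g 1)"
  using minimal_poly_alpha[OF assms] by (auto elim!: dvdE simp: poly_monom)

text \<open>
  Galois conjugation \<open>\<alpha> \<mapsto> z\<close>, in the form in which it preserves polynomial relations.
\<close>
lemma conjugate_root:
  assumes "n \<ge> 1" "ev g (alpha n) = 0" "z ^ (2 ^ (n - 1)) = - 1"
  shows "ev g z = 0"
  using minimal_poly_alpha[OF assms(1,2)] assms(3) by (auto elim!: dvdE simp: ev_simps)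

section \<open>The ring of cyclotomic integers and its units\<close>

lemma Z_alphaI: "x = ev p (alpha n) \<Longrightarrow> x \<in> Z_alpha n"
  by (auto simp: Z_alpha_def)

lemma Z_alphaE:
  assumes "x \<in> Z_alpha n"
  obtains p where "x = ev p (alpha n)"
  using assms by (auto simp: Z_alpha_def)

lemma Z_alpha_of_int: "of_int k \<in> Z_alpha n"
  by (rule Z_alphaI[of _ "[:k:]"]) (simp add: ev_simps)

lemma Z_alpha_0: "0 \<in> Z_alpha n" and Z_alpha_1: "1 \<in> Z_alpha n"
  using Z_alpha_of_int[of 0 n] Z_alpha_of_int[of 1 n] by simp_all

lemma Z_alpha_add: "x \<in> Z_alpha n \<Longrightarrow> y \<in> Z_alpha n \<Longrightarrow> x + y \<in> Z_alpha n"
  by (elim Z_alphaE) (metis Z_alphaI ev_add)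

lemma Z_alpha_diff: "x \<in> Z_alpha n \<Longrightarrow> y \<in> Z_alpha n \<Longrightarrow> x - y \<in> Z_alpha n"
  by (elim Z_alphaE) (metis Z_alphaI ev_diff)

lemma Z_alpha_mult: "x \<in> Z_alpha n \<Longrightarrow> y \<in> Z_alpha n \<Longrightarrow> x * y \<in> Z_alpha n"
  by (elim Z_alphaE) (metis Z_alphaI ev_mult)

lemma Z_alpha_power: "x \<in> Z_alpha n \<Longrightarrow> x ^ k \<in> Z_alpha n"
  by (induction k) (simp_all add: Z_alpha_1 Z_alpha_mult)

lemma Z_alpha_sum: "(\<And>i. i \<in> I \<Longrightarrow> f i \<in> Z_alpha n) \<Longrightarrow> sum f I \<in> Z_alpha n"
  by (induction I rule: infinite_finite_induct) (simp_all add: Z_alpha_0 Z_alpha_add)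

lemma alpha_nonzero: "alpha n \<noteq> 0"
  by (simp add: alpha_def)

lemma alpha_power_full: "alpha n ^ (2 ^ n) = 1"
proof -
  have "alpha n ^ (2 ^ n) = exp (of_nat (2 ^ n) * (2 * complex_of_real pi * \<i> / 2 ^ n))"
    unfolding alpha_def by (simp only: exp_of_nat_mult)
  also have "of_nat (2 ^ n) * (2 * complex_of_real pi * \<i> / 2 ^ n) = 2 * complex_of_real pi * \<i>"
    by simp
  finally show ?thesis by simp
qed

lemma alpha_powi_full: "alpha n powi (2 ^ n * k) = 1"
proof -
  have "alpha n powi (2 ^ n * k) = (alpha n powi int (2 ^ n)) powi k"
    by (simp add: power_int_mult)
  also have "alpha n powi int (2 ^ n) = 1"
    by (simp only: power_int_of_nat alpha_power_full)
  finally show ?thesis by simp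
qed

lemma alpha_powi_half_odd:
  assumes "n \<ge> 1" "odd j"
  shows "(alpha n powi j) ^ (2 ^ (n - 1)) = - 1"
proof -
  obtain k where k: "j = 2 * k + 1" using assms by (elim oddE)
  have "(alpha n powi j) ^ (2 ^ (n - 1)) = alpha n powi (j * 2 ^ (n - 1))"
    by (simp add: power_int_mult flip: power_int_of_nat)
  also have "j * 2 ^ (n - 1) = 2 ^ n * k + 2 ^ (n - 1)"
    using assms(1) by (cases n) (auto simp: k algebra_simps)
  also have "alpha n powi (2 ^ n * k + 2 ^ (n - 1)) = alpha n powi (int (2 ^ (n - 1)))"
    by (simp add: power_int_add alpha_nonzero alpha_powi_full)
  also have "\<dots> = - 1" by (simp only: power_int_of_nat alpha_power_half[OF assms(1)])
  finally show ?thesis .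
qed

lemma Z_alpha_powi: "alpha n powi j \<in> Z_alpha n"
proof -
  have "alpha n \<in> Z_alpha n" by (rule Z_alphaI[of _ "[:0, 1:]"]) (simp add: ev_simps)
  moreover have "alpha n powi j = alpha n ^ nat (j mod 2 ^ n)"
  proof -
    have "alpha n powi j = alpha n powi (2 ^ n * (j div 2 ^ n) + j mod 2 ^ n)" by simp
    also have "\<dots> = alpha n powi (j mod 2 ^ n)"
      by (simp only: power_int_add[OF disjI1[OF alpha_nonzero]] alpha_powi_full mult_1)
    also have "\<dots> = alpha n ^ nat (j mod 2 ^ n)" by (simp add: power_int_def)
    finally show ?thesis .
  qed
  ultimately show ?thesis by (simp add: Z_alpha_power)
qed

lemma Z_alpha_d: "d n j \<in> Z_alpha n"
  by (simp add: d_def Z_alpha_add Z_alpha_1 Z_alpha_powi)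

lemma alpha_cis: "alpha n = cis (2 * pi / 2 ^ n)"
  by (simp add: alpha_def cis_conv_exp mult_ac)

lemma cnj_alpha_powi: "cnj (alpha n powi j) = alpha n powi (- j)"
proof -
  have "cnj (alpha n) = inverse (alpha n)" by (simp add: alpha_cis cis_cnj)
  thus ?thesis by (simp add: power_int_minus power_int_inverse)
qed

lemma cnj_d: "cnj (d n j) = d n j"
  by (simp add: d_def cnj_alpha_powi add.commute del: complex_cnj_power_int)

lemma inverse_three_mod_two_power: "\<exists>m t :: nat. 3 * m = t * 2 ^ n + 1"
proof -
  have "2 ^ n mod 3 = (1::nat) \<or> 2 ^ n mod 3 = (2::nat)"
  proof (induction n)
    case (Suc n)
    thus ?case unfolding power_Suc by presburger
  qed simp
  hence "3 dvd (2 ^ n * 2 + 1 :: nat) \<or> 3 dvd (2 ^ n + 1 :: nat)" by presburger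
  thus ?thesis
    by (elim disjE dvdE) (metis mult.commute, metis mult_1)
qed

text \<open>
  With \<open>z = \<alpha>^j\<close>, up to the factor \<open>z\<close> the element is \<open>(z^3 - 1) / (z - 1)\<close>. Its inverse is a
  geometric sum in \<open>z^3\<close>, because \<open>z\<close> is itself a power of \<open>z^3\<close>.
\<close>
lemma d_unit:
  assumes n: "n \<ge> 1" and j: "odd j"
  obtains e where "e \<in> Z_alpha n" "d n j * e = 1"
proof -
  define z where "z = alpha n powi j"
  have znz: "z \<noteq> 0" by (simp add: z_def alpha_nonzero)
  have z1: "z ^ (2 ^ (n - 1)) = - 1" unfolding z_def by (rule alpha_powi_half_odd[OF n j])
  hence zne: "z \<noteq> 1" by auto
  have zN: "z ^ (2 ^ n) = 1"
  proof -
    have "z ^ (2 ^ n) = (z ^ (2 ^ (n - 1))) ^ 2"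
      using n by (cases n) (simp_all add: power_mult[symmetric] mult.commute)
    thus ?thesis using z1 by simp
  qed
  obtain m t :: nat where mt: "3 * m = t * 2 ^ n + 1" using inverse_three_mod_two_power by blast
  have zm: "z ^ (3 * m) = z"
    unfolding mt by (simp add: power_mult[of z "2 ^ n" t, unfolded mult.commute[of "2 ^ n" t]] zN)
  define S where "S = (\<Sum>i<m. (z ^ 3) ^ i)"
  have "(z - 1) * ((1 + z + z\<^sup>2) * S) = (z ^ 3 - 1) * S"
    by (simp add: algebra_simps power2_eq_square power3_eq_cube)
  also have "\<dots> = (z ^ 3) ^ m - 1" unfolding S_def by (simp add: power_diff_1_eq)
  also have "\<dots> = z - 1" by (simp add: zm flip: power_mult)
  finally have one: "(1 + z + z\<^sup>2) * S = 1" using zne by simp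
  have d_eq: "d n j = inverse z * (1 + z + z\<^sup>2)"
    using znz by (simp add: d_def z_def[symmetric] power_int_minus field_simps power2_eq_square)
  show ?thesis
  proof (rule that)
    show "z * S \<in> Z_alpha n" unfolding S_def z_def
      by (intro Z_alpha_mult Z_alpha_sum Z_alpha_power Z_alpha_powi)
    have "d n j * (z * S) = (inverse z * z) * ((1 + z + z\<^sup>2) * S)"
      by (simp only: d_eq mult_ac)
    thus "d n j * (z * S) = 1" using one znz by simp
  qed
qed


section \<open>Subgroups of the unit group\<close>

lemma unit_grp_simps:
  "mult (unit_grp n) = (*)" "one (unit_grp n) = 1"
  by (simp_all add: units_of_mult units_of_one Z_alpha_ring_def)

lemma carrier_unit_grp:
  "carrier (unit_grp n) = {x \<in> Z_alpha n. \<exists>y\<in>Z_alpha n. x * y = 1}"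
  by (auto simp: units_of_carrier Units_def Z_alpha_ring_def mult.commute)

lemma unit_grp_comm_group: "comm_group (unit_grp n)"
proof -
  interpret comm_monoid "Z_alpha_ring n"
    by unfold_locales
      (auto simp: Z_alpha_ring_def Z_alpha_mult Z_alpha_1 mult_ac)
  show ?thesis by (rule units_comm_group)
qed

lemma unit_grp_inv:
  assumes "x \<in> carrier (unit_grp n)"
  shows "inv\<^bsub>unit_grp n\<^esub> x = inverse x" "inverse x \<in> carrier (unit_grp n)" "x \<noteq> 0"
proof -
  interpret comm_group "unit_grp n" by (rule unit_grp_comm_group)
  have "x * inv\<^bsub>unit_grp n\<^esub> x = 1"
    using r_inv[OF assms] by (simp only: unit_grp_simps)
  thus "x \<noteq> 0" and eq: "inv\<^bsub>unit_grp n\<^esub> x = inverse x"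
    by (auto simp: inverse_unique)
  show "inverse x \<in> carrier (unit_grp n)" using inv_closed[OF assms] by (simp only: eq)
qed

lemma unit_grp_closed:
  assumes "x \<in> carrier (unit_grp n)" "y \<in> carrier (unit_grp n)"
  shows "x * y \<in> carrier (unit_grp n)"
proof -
  interpret comm_group "unit_grp n" by (rule unit_grp_comm_group)
  show ?thesis using m_closed[OF assms] by (simp only: unit_grp_simps)
qed

lemma one_in_unit_grp: "1 \<in> carrier (unit_grp n)"
  by (auto simp: carrier_unit_grp Z_alpha_1)

lemma subgroup_unit_grp_iff:
  "subgroup H (unit_grp n) \<longleftrightarrow> H \<subseteq> carrier (unit_grp n) \<and> 1 \<in> H \<and>
     (\<forall>x\<in>H. \<forall>y\<in>H. x * y \<in> H) \<and> (\<forall>x\<in>H. inverse x \<in> H)"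
  unfolding subgroup_def unit_grp_simps using unit_grp_inv(1)[of _ n] by (auto simp: subset_iff)

lemma subgroup_ofI:
  assumes "subgroup H (unit_grp n)" "subgroup K (unit_grp n)" "H \<subseteq> K"
  shows "subgroup_of (unit_grp n) H K"
  using group.subgroup_incl[OF comm_group.axioms(2)[OF unit_grp_comm_group] assms] assms(2)
  by (simp add: subgroup_of_def)

context
  fixes n :: nat and H :: "complex set"
  assumes H: "subgroup H (unit_grp n)"
begin

lemma subgroup_carrier: "x \<in> H \<Longrightarrow> x \<in> carrier (unit_grp n)"
  and subgroup_one: "1 \<in> H"
  and subgroup_mult: "x \<in> H \<Longrightarrow> y \<in> H \<Longrightarrow> x * y \<in> H"
  and subgroup_inverse: "x \<in> H \<Longrightarrow> inverse x \<in> H"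
  using H unfolding subgroup_unit_grp_iff by auto

lemma subgroup_power: "x \<in> H \<Longrightarrow> x ^ k \<in> H"
  by (induction k) (simp_all add: subgroup_one subgroup_mult)

lemma subgroup_prod: "(\<And>i. i \<in> I \<Longrightarrow> f i \<in> H) \<Longrightarrow> prod f I \<in> H"
  by (induction I rule: infinite_finite_induct) (simp_all add: subgroup_one subgroup_mult)

lemma generate_subset: "S \<subseteq> H \<Longrightarrow> generate (unit_grp n) S \<subseteq> H"
  using group.generate_subgroup_incl[OF comm_group.axioms(2)[OF unit_grp_comm_group]] H by blast

lemma cyc_subset: "x \<in> H \<Longrightarrow> cyc n x \<subseteq> H"
  unfolding cyc_def by (rule generate_subset) simp

lemma int_prod_subset: "(\<And>i. i \<in> I \<Longrightarrow> K i \<subseteq> H) \<Longrightarrow> int_prod K I \<subseteq> H"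
  unfolding int_prod_def by (auto intro!: subgroup_prod)

lemma subgroup_powers: "subgroup (powers H m) (unit_grp n)"
  unfolding subgroup_unit_grp_iff powers_def
proof (intro conjI ballI)
  show "(\<lambda>x. x ^ m) ` H \<subseteq> carrier (unit_grp n)" by (auto intro: subgroup_carrier subgroup_power)
  show "1 \<in> (\<lambda>x. x ^ m) ` H" by (rule image_eqI[of _ _ 1]) (simp_all add: subgroup_one)
  show "x * y \<in> (\<lambda>x. x ^ m) ` H" if "x \<in> (\<lambda>x. x ^ m) ` H" "y \<in> (\<lambda>x. x ^ m) ` H" for x y
    using that by (auto simp: subgroup_mult simp flip: power_mult_distrib)
  show "inverse x \<in> (\<lambda>x. x ^ m) ` H" if "x \<in> (\<lambda>x. x ^ m) ` H" for x
    using that by (auto simp: subgroup_inverse simp flip: power_inverse)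
qed

text \<open>
  Turns a statement about \<open>m\<close>-th powers of a generated group into one about its generators.
\<close>
lemma subgroup_roots: "subgroup {x \<in> carrier (unit_grp n). x ^ m \<in> H} (unit_grp n)"
  unfolding subgroup_unit_grp_iff
  by (auto simp: one_in_unit_grp subgroup_one unit_grp_closed power_mult_distrib subgroup_mult
      unit_grp_inv subgroup_inverse power_inverse)

end

lemma subgroup_generate:
  "S \<subseteq> carrier (unit_grp n) \<Longrightarrow> subgroup (generate (unit_grp n) S) (unit_grp n)"
  by (rule group.generate_is_subgroup[OF comm_group.axioms(2)[OF unit_grp_comm_group]])

lemma subgroup_cyc: "x \<in> carrier (unit_grp n) \<Longrightarrow> subgroup (cyc n x) (unit_grp n)"
  unfolding cyc_def by (rule subgroup_generate) simp

lemma subgroup_int_prod: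
  assumes "\<And>i. i \<in> I \<Longrightarrow> subgroup (K i) (unit_grp n)"
  shows "subgroup (int_prod K I) (unit_grp n)"
proof -
  have carr: "subgroup (carrier (unit_grp n)) (unit_grp n)"
    by (rule group.subgroup_self[OF comm_group.axioms(2)[OF unit_grp_comm_group]])
  note K = assms[unfolded subgroup_unit_grp_iff]
  show ?thesis
    unfolding subgroup_unit_grp_iff
  proof (intro conjI ballI)
    show "int_prod K I \<subseteq> carrier (unit_grp n)"
      by (rule int_prod_subset[OF carr]) (use K in blast)
    show "1 \<in> int_prod K I"
      unfolding int_prod_def using K by (auto intro!: exI[of _ "\<lambda>_. 1"])
    show "x * y \<in> int_prod K I" if xy: "x \<in> int_prod K I" "y \<in> int_prod K I" for x y
    proof -
      obtain f g where "x = prod f I" "y = prod g I" "\<forall>i\<in>I. f i \<in> K i" "\<forall>i\<in>I. g i \<in> K i"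
        using xy unfolding int_prod_def by auto
      thus ?thesis unfolding int_prod_def using K
        by (auto intro!: exI[of _ "\<lambda>i. f i * g i"] simp: prod.distrib)
    qed
    show "inverse x \<in> int_prod K I" if x: "x \<in> int_prod K I" for x
    proof -
      obtain f where "x = prod f I" "\<forall>i\<in>I. f i \<in> K i"
        using x unfolding int_prod_def by auto
      thus ?thesis unfolding int_prod_def using K
        by (auto intro!: exI[of _ "\<lambda>i. inverse (f i)"] simp: prod_inversef[symmetric] o_def)
    qed
  qed
qed

lemma factor_in_int_prod:
  assumes "finite I" "i \<in> I" "x \<in> K i" "\<And>j. j \<in> I \<Longrightarrow> 1 \<in> K j"
  shows "x \<in> int_prod K I"
  unfolding int_prod_def using assms
  by (auto intro!: exI[of _ "\<lambda>j. if j = i then x else 1"])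

section \<open>Congruences modulo 2\<close>

lemma cong2_refl: "cong2 n x x"
  by (auto simp: cong2_def Z_alpha_0 intro: bexI[of _ 0])

lemma cong2_trans: "cong2 n x y \<Longrightarrow> cong2 n y z \<Longrightarrow> cong2 n x z"
proof -
  assume "cong2 n x y" "cong2 n y z"
  then obtain s t where "s \<in> Z_alpha n" "t \<in> Z_alpha n" "x - y = 2 * s" "y - z = 2 * t"
    by (auto simp: cong2_def)
  thus ?thesis unfolding cong2_def
    by (intro bexI[of _ "s + t"] Z_alpha_add) (simp_all add: algebra_simps)
qed

lemma cong2_sym: "cong2 n x y \<Longrightarrow> cong2 n y x"
proof -
  assume "cong2 n x y"
  then obtain s where "s \<in> Z_alpha n" "x - y = 2 * s" by (auto simp: cong2_def)
  thus ?thesis unfolding cong2_def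
    by (intro bexI[of _ "0 - s"] Z_alpha_diff Z_alpha_0) (simp_all add: algebra_simps)
qed

lemma cong2_mult_left: "a \<in> Z_alpha n \<Longrightarrow> cong2 n x y \<Longrightarrow> cong2 n (a * x) (a * y)"
proof -
  assume "a \<in> Z_alpha n" "cong2 n x y"
  then obtain s where "s \<in> Z_alpha n" "x - y = 2 * s" by (auto simp: cong2_def)
  thus ?thesis using \<open>a \<in> Z_alpha n\<close> unfolding cong2_def
    by (intro bexI[of _ "a * s"] Z_alpha_mult) (simp_all flip: right_diff_distrib)
qed

lemma cong2_mult:
  assumes "cong2 n x y" "cong2 n u v" "u \<in> Z_alpha n" "y \<in> Z_alpha n"
  shows "cong2 n (x * u) (y * v)"
  using cong2_trans[OF cong2_mult_left[OF assms(3,1)], of "y * v"] cong2_mult_left[OF assms(4,2)]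
  by (simp add: mult.commute)

lemma cong2_power:
  assumes "cong2 n x y" "x \<in> Z_alpha n" "y \<in> Z_alpha n"
  shows "cong2 n (x ^ k) (y ^ k)"
  by (induction k)
    (simp_all add: cong2_refl cong2_mult assms Z_alpha_power)

text \<open>
  Squaring is additive modulo 2; the error term here is exactly \<open>2 d\<^sub>j\<close>.
\<close>
lemma d_square_cong: "cong2 n (d n j ^ 2) (d n (2 * j))"
proof -
  let ?z = "alpha n powi j"
  have nz: "?z \<noteq> 0" by (simp add: alpha_nonzero)
  have dj: "d n j = 1 + ?z + inverse ?z" by (simp add: d_def power_int_minus)
  have d2j: "d n (2 * j) = 1 + ?z ^ 2 + inverse ?z ^ 2"
    by (simp add: d_def power_int_minus power_inverse power_int_mult mult.commute[of 2])
  have "d n j ^ 2 - d n (2 * j) = 2 * d n j + (?z * inverse ?z - 1) * 2"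
    unfolding dj d2j by (simp add: power2_eq_square algebra_simps)
  hence "d n j ^ 2 - d n (2 * j) = 2 * d n j" using nz by simp
  thus ?thesis unfolding cong2_def by (auto intro: Z_alpha_d)
qed

lemma d_two_power_cong: "cong2 n (d n j ^ (2 ^ k)) (d n (2 ^ k * j))"
proof (induction k)
  case 0
  show ?case by (simp add: cong2_refl)
next
  case (Suc k)
  have "cong2 n ((d n j ^ (2 ^ k)) ^ 2) (d n (2 ^ k * j) ^ 2)"
    by (rule cong2_power[OF Suc]) (simp_all add: Z_alpha_power Z_alpha_d)
  moreover have "(d n j ^ (2 ^ k)) ^ 2 = d n j ^ (2 ^ Suc k)"
    by (simp add: mult.commute flip: power_mult)
  ultimately show ?case
    using cong2_trans[OF _ d_square_cong[of n "2 ^ k * j"]] by (simp add: mult.assoc)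
qed

lemma d_reflect:
  assumes "n \<ge> 1"
  shows "d n (2 ^ (n - 1) - j) = 2 - d n j"
proof -
  have "alpha n powi int (2 ^ (n - 1)) = - 1"
    by (simp only: power_int_of_nat alpha_power_half[OF assms])
  hence half: "alpha n powi (2 ^ (n - 1)) = - 1" by simp
  have "alpha n powi (- (2 ^ (n - 1))) = - 1"
    by (simp only: power_int_minus half) simp
  hence "alpha n powi (2 ^ (n - 1) - j) = - (alpha n powi (- j))"
    "alpha n powi (- (2 ^ (n - 1) - j)) = - (alpha n powi j)"
    using half power_int_add[OF disjI1[OF alpha_nonzero], of n "2 ^ (n - 1)" "- j"]
      power_int_add[OF disjI1[OF alpha_nonzero], of n "- (2 ^ (n - 1))" j]
    by (simp_all add: add.commute)
  thus ?thesis by (simp add: d_def)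
qed

lemma d_reflect_cong: "n \<ge> 1 \<Longrightarrow> cong2 n (d n (2 ^ (n - 1) - j)) (d n j)"
  unfolding cong2_def d_reflect
  by (intro bexI[of _ "1 - d n j"]) (simp_all add: Z_alpha_diff Z_alpha_1 Z_alpha_d algebra_simps)


section \<open>The inclusions between D, E and F\<close>

lemma d_in_unit_grp: "n \<ge> 1 \<Longrightarrow> odd j \<Longrightarrow> d n j \<in> carrier (unit_grp n)"
  by (metis (mono_tags, lifting) Z_alpha_d carrier_unit_grp d_unit mem_Collect_eq)

lemma subgroup_D: "n \<ge> 1 \<Longrightarrow> subgroup (grp_D n) (unit_grp n)"
  unfolding grp_D_def by (rule subgroup_generate) (auto simp: d_in_unit_grp)

lemma d_in_D: "odd j \<Longrightarrow> 1 \<le> j \<Longrightarrow> j \<le> 2 ^ (n - 1) - 3 \<Longrightarrow> d n j \<in> grp_D n"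
  unfolding grp_D_def by (rule generate.incl) simp

lemma D_subset:
  assumes "subgroup H (unit_grp n)"
    and "\<And>j. odd j \<Longrightarrow> 1 \<le> j \<Longrightarrow> j \<le> 2 ^ (n - 1) - 3 \<Longrightarrow> d n j \<in> H"
  shows "grp_D n \<subseteq> H"
  unfolding grp_D_def by (rule generate_subset[OF assms(1)]) (use assms(2) in auto)

lemma D_in_Z_alpha: "n \<ge> 1 \<Longrightarrow> x \<in> grp_D n \<Longrightarrow> x \<in> Z_alpha n"
  using subgroup_carrier[OF subgroup_D] by (auto simp: carrier_unit_grp)

text \<open>
  The elements of \<open>D\<close> are real because the generators are fixed by complex conjugation.
\<close>
lemma cnj_D:
  assumes n: "n \<ge> 1" and x: "x \<in> grp_D n"
  shows "cnj x = x"
proof -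
  have "subgroup {x \<in> carrier (unit_grp n). cnj x = x} (unit_grp n)"
    unfolding subgroup_unit_grp_iff
    by (auto simp: one_in_unit_grp unit_grp_closed unit_grp_inv)
  hence "grp_D n \<subseteq> {x \<in> carrier (unit_grp n). cnj x = x}"
    by (rule D_subset) (simp add: d_in_unit_grp[OF n] cnj_d)
  thus ?thesis using x by auto
qed

lemma subgroup_E:
  assumes n: "n \<ge> 1"
  shows "subgroup (grp_E n) (unit_grp n)"
  unfolding subgroup_unit_grp_iff grp_E_def
proof (intro conjI ballI)
  note D = subgroup_D[OF n] and Z = D_in_Z_alpha[OF n]
  show "{x \<in> grp_D n. cong2 n x 1} \<subseteq> carrier (unit_grp n)"
    using subgroup_carrier[OF D] by auto
  show "1 \<in> {x \<in> grp_D n. cong2 n x 1}" by (simp add: subgroup_one[OF D] cong2_refl)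
  show "x * y \<in> {x \<in> grp_D n. cong2 n x 1}"
    if "x \<in> {x \<in> grp_D n. cong2 n x 1}" "y \<in> {x \<in> grp_D n. cong2 n x 1}" for x y
    using that cong2_mult[of n x 1 y 1] by (simp add: subgroup_mult[OF D] Z Z_alpha_1)
  show "inverse x \<in> {x \<in> grp_D n. cong2 n x 1}" if x: "x \<in> {x \<in> grp_D n. cong2 n x 1}" for x
  proof -
    have "inverse x \<in> grp_D n" using x by (simp add: subgroup_inverse[OF D])
    moreover have "cong2 n (inverse x * x) (inverse x * 1)"
      using x calculation by (intro cong2_mult_left Z) auto
    moreover have "x \<noteq> 0" using x subgroup_carrier[OF D] unit_grp_inv(3) by auto
    ultimately show ?thesis by (simp add: cong2_sym)
  qed
qed

text \<open>
  The index 1 is left out for \<open>k = 0\<close> because its reflection \<open>2^(n-1) - 1\<close> is not the index of a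
  generator of \<open>D\<close>.
\<close>
definition factor_indices :: "nat \<Rightarrow> nat \<Rightarrow> int set" where
  "factor_indices n k = (if k = 0 then idx_A n 0 - {1} else idx_A n k)"

lemma part_F_eq: "part_F n k = int_prod (\<lambda>j. cyc n (q n k j ^ (2 ^ k))) (factor_indices n k)"
  by (simp add: part_F_def factor_indices_def)

lemma factor_indices_subset: "factor_indices n k \<subseteq> idx_A n k"
  by (cases "k = 0") (auto simp: factor_indices_def)

lemma finite_factor_indices: "finite (factor_indices n k)"
  by (rule finite_subset[OF factor_indices_subset], rule finite_subset[of _ "{1..2 ^ (n - 2 - k) - 1}"])
    (auto simp: idx_A_def)

text \<open>
  Both indices that occur in \<open>q(k,j)\<close> belong to generators of \<open>D\<close>. For \<open>k \<ge> 1\<close> they are below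
  \<open>2^(n-2)\<close>; for \<open>k = 0\<close> the upper bound is the reason for \<open>j \<noteq> 1\<close>.
\<close>
lemma factor_indices_range:
  assumes n: "n \<ge> 4" and k: "k \<le> n - 3" and j: "j \<in> factor_indices n k"
  shows "odd j" "1 \<le> j" "j \<le> 2 ^ (n - 1) - 3"
    and "odd (2 ^ (n - 1 - k) - j)" "1 \<le> 2 ^ (n - 1 - k) - j" "2 ^ (n - 1 - k) - j \<le> 2 ^ (n - 1) - 3"
proof -
  define a :: int where "a = 2 ^ (n - 2 - k)"
  have "n - 2 - k = Suc (n - 3 - k)" using n k by auto
  hence a2: "a = 2 * 2 ^ (n - 3 - k)" by (simp add: a_def)
  have a_ge: "a \<ge> 2" by (simp add: a2)
  have "n - 1 - k = Suc (n - 2 - k)" using n k by auto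
  hence e: "2 ^ (n - 1 - k) = 2 * a" by (simp add: a_def)
  have "n - 1 = k + (n - 1 - k)" using n k by auto
  hence e': "(2::int) ^ (n - 1) = 2 ^ k * (2 * a)" by (metis e power_add)
  have j': "odd j" "1 \<le> j" "j \<le> a - 1" "k = 0 \<Longrightarrow> j \<noteq> 1"
    using j subsetD[OF factor_indices_subset j] by (simp_all add: factor_indices_def idx_A_def a_def)
  show "odd j" "1 \<le> j" by (fact j')+
  show "odd (2 ^ (n - 1 - k) - j)" using j'(1) by (simp only: e) simp
  show "1 \<le> 2 ^ (n - 1 - k) - j" using j' a_ge unfolding e by linarith
  show "j \<le> 2 ^ (n - 1) - 3" "2 ^ (n - 1 - k) - j \<le> 2 ^ (n - 1) - 3"
  proof -
    have "j \<le> 2 ^ (n - 1) - 3 \<and> 2 ^ (n - 1 - k) - j \<le> 2 ^ (n - 1) - 3"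
    proof (cases "k = 0")
      case True
      hence "j \<noteq> 1" "(2::int) ^ (n - 1) = 2 * a" using j'(4) e' by auto
      moreover have "j \<noteq> 2" using j'(1) by auto
      ultimately show ?thesis using j' a_ge e by linarith
    next
      case False
      hence "(2::int) ^ 1 \<le> 2 ^ k" by (intro power_increasing) auto
      hence "(2::int) * (2 * a) \<le> 2 ^ k * (2 * a)" using a_ge by (intro mult_right_mono) auto
      thus ?thesis using j' a_ge e e' by linarith
    qed
    thus "j \<le> 2 ^ (n - 1) - 3" "2 ^ (n - 1 - k) - j \<le> 2 ^ (n - 1) - 3" by auto
  qed
qed

lemma q_in_D:
  assumes "n \<ge> 4" "k \<le> n - 3" "j \<in> factor_indices n k"
  shows "q n k j \<in> grp_D n"
proof -
  have D: "subgroup (grp_D n) (unit_grp n)" using assms by (intro subgroup_D) simp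
  show ?thesis unfolding q_def
    by (intro subgroup_mult[OF D] subgroup_inverse[OF D] d_in_D factor_indices_range[OF assms])
qed

text \<open>
  Raising to the power \<open>2^k\<close> multiplies the indices by \<open>2^k\<close> modulo 2. The two indices in \<open>q(k,j)\<close> then
  become \<open>2^k j\<close> and its reflection at \<open>2^(n-1)\<close>, where \<open>d\<close> takes congruent values.
\<close>
lemma q_power_in_E:
  assumes n: "n \<ge> 4" and k: "k \<le> n - 3" and j: "j \<in> factor_indices n k"
  shows "q n k j ^ (2 ^ k) \<in> grp_E n"
proof -
  have n1: "n \<ge> 1" using n by simp
  note D = subgroup_D[OF n1]
  have dj: "d n j \<in> grp_D n" by (intro d_in_D factor_indices_range[OF assms])
  have nz: "d n j \<noteq> 0" using subgroup_carrier[OF D dj] by (rule unit_grp_inv(3))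
  have "(2::int) ^ k * 2 ^ (n - 1 - k) = 2 ^ (n - 1)"
    using n k by (simp flip: power_add)
  hence "2 ^ k * (2 ^ (n - 1 - k) - j) = 2 ^ (n - 1) - 2 ^ k * j"
    by (simp add: right_diff_distrib)
  hence "cong2 n (d n (2 ^ (n - 1 - k) - j) ^ (2 ^ k)) (d n (2 ^ (n - 1) - 2 ^ k * j))"
    using d_two_power_cong[of n "2 ^ (n - 1 - k) - j" k] by simp
  hence "cong2 n (d n (2 ^ (n - 1 - k) - j) ^ (2 ^ k)) (d n j ^ (2 ^ k))"
    using d_reflect_cong[OF n1] d_two_power_cong cong2_sym cong2_trans by blast
  hence "cong2 n (inverse (d n j) ^ (2 ^ k) * d n (2 ^ (n - 1 - k) - j) ^ (2 ^ k))
      (inverse (d n j) ^ (2 ^ k) * d n j ^ (2 ^ k))"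
    by (intro cong2_mult_left Z_alpha_power D_in_Z_alpha[OF n1] subgroup_inverse[OF D] dj)
  hence "cong2 n (q n k j ^ (2 ^ k)) 1"
    using nz by (simp add: q_def power_mult_distrib[symmetric])
  thus ?thesis unfolding grp_E_def
    using subgroup_power[OF D q_in_D[OF assms]] by simp
qed

text \<open>
  The power is congruent to \<open>d\<close> at \<open>2^(n-2)\<close>. That index is its own reflection, so the value there is
  equal to 1.
\<close>
lemma d_1_power_in_E:
  assumes n: "n \<ge> 4"
  shows "d n 1 ^ (2 ^ (n - 2)) \<in> grp_E n"
proof -
  have n1: "n \<ge> 1" using n by simp
  have "(2::int) ^ 3 \<le> 2 ^ (n - 1)" using n by (intro power_increasing) auto
  hence "d n 1 \<in> grp_D n" by (intro d_in_D) auto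
  hence D: "d n 1 ^ (2 ^ (n - 2)) \<in> grp_D n" by (rule subgroup_power[OF subgroup_D[OF n1]])
  have "(2::int) ^ (n - 1) = 2 * 2 ^ (n - 2)" using n by (simp flip: power_Suc)
  hence "d n (2 ^ (n - 2)) = 2 - d n (2 ^ (n - 2))"
    using d_reflect[OF n1, of "2 ^ (n - 2)"] by simp
  hence "d n (2 ^ (n - 2)) = 1" by (simp add: algebra_simps)
  thus ?thesis using D d_two_power_cong[of n 1 "n - 2"] by (simp add: grp_E_def)
qed

lemma subgroup_part_F:
  assumes "n \<ge> 4" "k \<le> n - 3"
  shows "subgroup (part_F n k) (unit_grp n)"
proof -
  have n1: "n \<ge> 1" using assms by simp
  show ?thesis unfolding part_F_eq
    by (intro subgroup_int_prod subgroup_cyc subgroup_carrier[OF subgroup_E[OF n1]]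
        q_power_in_E assms)
qed

lemma subgroup_part_F_prod:
  assumes "n \<ge> 4"
  shows "subgroup (int_prod (part_F n) {0..n - 3}) (unit_grp n)"
  by (intro subgroup_int_prod subgroup_part_F assms) auto

lemma grp_F_eq:
  "grp_F n = {x * y | x y. x \<in> cyc n (d n 1 ^ (2 ^ (n - 2))) \<and> y \<in> int_prod (part_F n) {0..n - 3}}"
  unfolding grp_F_def set_mult_def unit_grp_simps by auto

lemma subgroup_F:
  assumes n: "n \<ge> 4"
  shows "subgroup (grp_F n) (unit_grp n)"
proof -
  have n1: "n \<ge> 1" using n by simp
  show ?thesis unfolding grp_F_def
    by (intro comm_group.mult_subgroups unit_grp_comm_group subgroup_part_F_prod n subgroup_cyc
        subgroup_carrier[OF subgroup_E[OF n1]] d_1_power_in_E)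
qed

lemma F_subset_E:
  assumes n: "n \<ge> 4"
  shows "grp_F n \<subseteq> grp_E n"
proof -
  have n1: "n \<ge> 1" using n by simp
  note E = subgroup_E[OF n1]
  have "int_prod (part_F n) {0..n - 3} \<subseteq> grp_E n"
    unfolding part_F_eq
    by (intro int_prod_subset[OF E] cyc_subset[OF E] q_power_in_E n) auto
  moreover have "cyc n (d n 1 ^ (2 ^ (n - 2))) \<subseteq> grp_E n"
    by (intro cyc_subset[OF E] d_1_power_in_E n)
  ultimately show ?thesis unfolding grp_F_eq using subgroup_mult[OF E] by blast
qed

lemma generator_in_cyc: "x \<in> cyc n x"
  unfolding cyc_def by (rule generate.incl) simp

lemma one_in_cyc: "1 \<in> cyc n x"
  unfolding cyc_def using generate.one[of "unit_grp n" "{x}"] by (simp add: unit_grp_simps)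

lemma d_1_power_in_F: "n \<ge> 4 \<Longrightarrow> d n 1 ^ (2 ^ (n - 2)) \<in> grp_F n"
  unfolding grp_F_eq using subgroup_one[OF subgroup_part_F_prod, of n] generator_in_cyc
  by (metis (mono_tags, lifting) mem_Collect_eq mult.right_neutral)

lemma q_power_in_F:
  assumes n: "n \<ge> 4" and k: "k \<le> n - 3" and j: "j \<in> factor_indices n k"
  shows "q n k j ^ (2 ^ k) \<in> grp_F n"
proof -
  have "q n k j ^ (2 ^ k) \<in> part_F n k"
    unfolding part_F_eq
    by (rule factor_in_int_prod[OF finite_factor_indices j]) (rule generator_in_cyc one_in_cyc)+
  hence "q n k j ^ (2 ^ k) \<in> int_prod (part_F n) {0..n - 3}"
    using k by (intro factor_in_int_prod[of _ k] subgroup_one[OF subgroup_part_F[OF n]]) auto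
  thus ?thesis unfolding grp_F_eq using one_in_cyc
    by (metis (mono_tags, lifting) mem_Collect_eq mult.left_neutral)
qed

text \<open>
  Descent on the index. An odd \<open>j \<ge> 3\<close> lies strictly between some \<open>2^m\<close> and \<open>2^(m+1)\<close>; its reflection
  \<open>i = 2^(m+1) - j\<close> is smaller, and \<open>d\<^sub>j = d\<^sub>i q(k,i)\<close> for \<open>k = n - 2 - m\<close>. Since \<open>2^(n-2) = 2^k 2^m\<close>, the
  power of \<open>q(k,i)\<close> that appears is a power of a generator of \<open>F\<close>.
\<close>
lemma d_power_in_F:
  assumes n: "n \<ge> 4" and j: "odd j" "1 \<le> j" "j \<le> 2 ^ (n - 1) - 3"
  shows "d n j ^ (2 ^ (n - 2)) \<in> grp_F n"
  using j
proof (induction "nat j" arbitrary: j rule: less_induct)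
  case less
  note F = subgroup_F[OF n]
  show ?case
  proof (cases "j = 1")
    case True
    thus ?thesis using d_1_power_in_F[OF n] by simp
  next
    case False
    moreover have "j \<noteq> 2" using less.prems by auto
    ultimately have j3: "j \<ge> 3" using less.prems by linarith
    have nat_ge: "1 \<le> nat j" "(2::nat) \<le> 2" using j3 by linarith+
    obtain m where m: "2 ^ m \<le> nat j" "nat j < 2 ^ (m + 1)"
      using ex_power_ivl1[OF nat_ge(2,1)] by blast
    have "int (2 ^ m) \<le> j" "j < int (2 ^ (m + 1))" using m j3 by linarith+
    hence m': "2 ^ m \<le> j" "j < 2 * 2 ^ m" by simp_all
    have m1: "m \<ge> 1" using m'(2) j3 by (cases m) auto
    have "2 ^ m \<noteq> j" using less.prems m1 by auto
    hence m_lt: "2 ^ m < j" using m' by simp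
    have "(2::int) ^ m < 2 ^ (n - 1)" using m' less.prems by linarith
    hence mn: "m < n - 1" by simp
    define k where "k = n - 2 - m"
    define i where "i = 2 ^ (m + 1) - j"
    have k: "k \<le> n - 3" "n - 1 - k = m + 1" "n - 2 - k = m" using mn m1 n by (auto simp: k_def)
    have i: "odd i" "1 \<le> i" "i \<le> 2 ^ m - 1" "i < j"
      using m' m_lt less.prems by (auto simp: i_def)
    \<comment> \<open>The excluded index 1 would come from j = 2^(n-1) - 1, which is too large.\<close>
    have "i \<noteq> 1" if "k = 0"
    proof
      assume "i = 1"
      have "m + 1 = n - 1" using that mn by (auto simp: k_def)
      hence "j = 2 ^ (n - 1) - 1" using \<open>i = 1\<close> by (simp add: i_def)
      thus False using less.prems by simp
    qed
    moreover have "i \<in> idx_A n k" using i unfolding idx_A_def k by simp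
    ultimately have ik: "i \<in> factor_indices n k" by (cases "k = 0") (simp_all add: factor_indices_def)
    have "d n i ^ (2 ^ (n - 2)) \<in> grp_F n"
      using i less.prems by (intro less.hyps) auto
    moreover have "(q n k i ^ (2 ^ k)) ^ (2 ^ m) \<in> grp_F n"
      by (rule subgroup_power[OF F q_power_in_F[OF n k(1) ik]])
    ultimately have "d n i ^ (2 ^ (n - 2)) * (q n k i ^ (2 ^ k)) ^ (2 ^ m) \<in> grp_F n"
      by (rule subgroup_mult[OF F])
    moreover have "(q n k i ^ (2 ^ k)) ^ (2 ^ m) = q n k i ^ (2 ^ (n - 2))"
      using mn n by (simp add: k_def flip: power_mult power_add)
    moreover have "d n i * q n k i = d n j"
    proof -
      have "d n i \<noteq> 0" using i n by (intro unit_grp_inv(3)[OF d_in_unit_grp]) auto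
      moreover have "2 ^ (n - 1 - k) - i = j" unfolding k i_def by simp
      ultimately show ?thesis by (simp add: q_def)
    qed
    ultimately show ?thesis by (simp flip: power_mult_distrib)
  qed
qed

lemma D_powers_subset_F:
  assumes n: "n \<ge> 4"
  shows "powers (grp_D n) (2 ^ (n - 2)) \<subseteq> grp_F n"
proof -
  have "grp_D n \<subseteq> {x \<in> carrier (unit_grp n). x ^ (2 ^ (n - 2)) \<in> grp_F n}"
    using n by (intro D_subset subgroup_roots[OF subgroup_F[OF n]])
      (simp add: d_in_unit_grp d_power_in_F)
  thus ?thesis by (auto simp: powers_def)
qed

section \<open>Strictness of the inclusions\<close>

lemma half_notin_Z_alpha:
  assumes "n \<ge> 1" "x \<in> Z_alpha n"
  shows "2 * x \<noteq> 1"
proof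
  assume x: "2 * x = 1"
  obtain p where "x = ev p (alpha n)" using assms(2) by (rule Z_alphaE)
  hence "ev (smult 2 p - 1) (alpha n) = 0" using x by (simp add: ev_simps)
  hence "even (poly (smult 2 p - 1) 1)" by (rule even_at_one_if_root_alpha[OF assms(1)])
  thus False by simp
qed

text \<open>
  Otherwise the \<open>2^(n-3)\<close>-th power of \<open>d\<^sub>1\<close>, and with it \<open>d\<close> at \<open>2^(n-3)\<close>, is 1 modulo 2. With the
  primitive eighth root of unity \<open>b\<close> this says that 2 divides \<open>b + b^(-1)\<close>; but the square of that sum
  is 2, which is not divisible by 4.
\<close>
lemma d_1_notin_E:
  assumes n: "n \<ge> 4"
  shows "d n 1 \<notin> grp_E n"
proof
  assume "d n 1 \<in> grp_E n"
  hence "cong2 n (d n 1) 1" by (simp add: grp_E_def)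
  hence "cong2 n (d n 1 ^ (2 ^ (n - 3))) (1 ^ (2 ^ (n - 3)))"
    by (rule cong2_power) (simp_all add: Z_alpha_d Z_alpha_1)
  hence "cong2 n (d n (2 ^ (n - 3))) 1"
    using cong2_trans[OF cong2_sym[OF d_two_power_cong[of n 1 "n - 3"]]] by simp
  then obtain t where t: "t \<in> Z_alpha n" "d n (2 ^ (n - 3)) - 1 = 2 * t"
    by (auto simp: cong2_def)
  define b where "b = alpha n ^ (2 ^ (n - 3))"
  have bnz: "b \<noteq> 0" by (simp add: b_def alpha_nonzero)
  have "alpha n powi (2 ^ (n - 3)) = alpha n powi int (2 ^ (n - 3))" by simp
  also have "\<dots> = b" by (simp only: power_int_of_nat b_def)
  finally have "d n (2 ^ (n - 3)) = 1 + b + inverse b" by (simp add: d_def power_int_minus)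
  hence bt: "b + inverse b = 2 * t" using t by simp
  have "b ^ 4 = alpha n ^ (2 ^ (n - 3) * 2 ^ 2)" by (simp add: b_def power_mult)
  also have "2 ^ (n - 3) * 2 ^ 2 = (2 ^ (n - 1) :: nat)"
  proof -
    have "n - 1 = n - 3 + 2" using n by simp
    thus ?thesis by (simp only: power_add)
  qed
  also have "alpha n ^ (2 ^ (n - 1)) = - 1" using n by (intro alpha_power_half) simp
  finally have b4: "b ^ 4 = - 1" .
  have "b ^ 2 * (b + inverse b) ^ 2 = (b * b + b * inverse b) ^ 2"
    by (simp add: power_mult_distrib flip: distrib_left)
  also have "\<dots> = b ^ 4 + 2 * b ^ 2 + 1"
    using bnz by (simp add: power2_eq_square algebra_simps power4_eq_xxxx)
  also have "\<dots> = b ^ 2 * 2" using b4 by simp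
  finally have "(b + inverse b) ^ 2 = 2" using bnz by simp
  hence "2 * t ^ 2 = 1" by (simp add: bt power_mult_distrib)
  thus False using half_notin_Z_alpha[of n "t ^ 2"] n t(1) by (simp add: Z_alpha_power)
qed

lemma alpha_plus_inverse:
  assumes "n \<ge> 4"
  shows "alpha n + inverse (alpha n) = complex_of_real (2 * cos (2 * pi / 2 ^ n))"
    and "2 * cos (2 * pi / 2 ^ n) > 1"
proof -
  show "alpha n + inverse (alpha n) = complex_of_real (2 * cos (2 * pi / 2 ^ n))"
    by (simp add: alpha_cis complex_eq_iff cis_inverse)
  have "(2::real) ^ 4 \<le> 2 ^ n" using assms by (intro power_increasing) auto
  hence "2 * pi / 2 ^ n \<le> 2 * pi / 16" by (intro divide_left_mono) auto
  also have "\<dots> < pi / 3" by simp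
  finally have "cos (2 * pi / 2 ^ n) > cos (pi / 3)"
    by (intro cos_monotone_0_pi) auto
  thus "2 * cos (2 * pi / 2 ^ n) > 1" by (simp add: cos_60)
qed

text \<open>
  A relation \<open>d\<^sub>3 y^2 = 2 - d\<^sub>3\<close> is transported from \<open>\<alpha>\<close> to a cube root \<open>b\<close> of \<open>\<alpha>\<close>. There \<open>d\<^sub>3\<close> becomes
  \<open>1 + c\<close> with \<open>c = 2 cos (2\<pi>/2^n) > 1\<close>, so the right-hand side is negative. The image of \<open>y\<close> is again
  real, because being real is the polynomial relation \<open>p(x) = p(x^(2^n - 1))\<close>.
\<close>
lemma q_not_square:
  assumes n: "n \<ge> 4" and y: "y \<in> Z_alpha n" and real: "cnj y = y"
  shows "q n 0 3 \<noteq> y ^ 2"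
proof
  assume qy: "q n 0 3 = y ^ 2"
  have n1: "n \<ge> 1" using n by simp
  let ?a = "alpha n" and ?N = "2 ^ n :: nat"
  have N: "?N \<ge> 3" using power_increasing[of 2 n "2::nat"] n by simp
  obtain m t :: nat where mt: "3 * m = t * 2 ^ n + 1" using inverse_three_mod_two_power by blast
  have "odd (3 * m)" unfolding mt using n1 by simp
  hence "odd (int m)" by simp
  define b where "b = ?a powi int m"
  have bm: "b = ?a ^ m" by (simp add: b_def)
  have b_root: "b ^ (2 ^ (n - 1)) = - 1"
    unfolding b_def by (rule alpha_powi_half_odd[OF n1 \<open>odd (int m)\<close>])
  have "b ^ 3 = ?a ^ (3 * m)" by (simp add: bm mult.commute flip: power_mult)
  also have "\<dots> = (?a ^ ?N) ^ t * ?a" unfolding mt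
    by (simp only: power_add power_mult mult.commute[of t] power_one_right)
  finally have b3: "b ^ 3 = ?a" by (simp add: alpha_power_full)
  have root_full: "z ^ ?N = 1" "z \<noteq> 0" if "z ^ (2 ^ (n - 1)) = - 1" for z :: complex
  proof -
    have "z ^ ?N = (z ^ (2 ^ (n - 1))) ^ 2"
      using n1 by (cases n) (simp_all add: power_mult[symmetric] mult.commute)
    thus "z ^ ?N = 1" using that by simp
    thus "z \<noteq> 0" by (auto simp: power_0_left)
  qed
  have power_neg: "z ^ (?N - k) = inverse (z ^ k)"
    if "z ^ (2 ^ (n - 1)) = - 1" "k \<le> ?N" for z :: complex and k
    using root_full[OF that(1)] that(2) by (simp add: power_diff divide_inverse)
  note a_root = alpha_power_half[OF n1]
  \<comment> \<open>The integer polynomial whose value at a root of unity z of order 2^n is 1 + z^3 + z^(-3).\<close>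
  define P3 where "P3 = 1 + monom 1 3 + monom (1::int) (?N - 3)"
  have P3: "ev P3 z = 1 + z ^ 3 + inverse (z ^ 3)" if "z ^ (2 ^ (n - 1)) = - 1" for z
    using power_neg[OF that N] by (simp add: P3_def ev_simps)
  obtain p where p: "y = ev p ?a" using y by (rule Z_alphaE)
  have d3: "d n 3 = ev P3 ?a" by (simp add: P3[OF a_root] d_def power_int_minus)
  have "d n 3 \<noteq> 0" using n by (intro unit_grp_inv(3)[OF d_in_unit_grp]) auto
  hence "d n 3 * y ^ 2 = 2 - d n 3"
    unfolding qy[symmetric] q_def using d_reflect[OF n1, of 3] by simp
  hence "ev (P3 * p ^ 2 - ([:2:] - P3)) ?a = 0"
    by (simp add: ev_simps p d3)
  hence "ev (P3 * p ^ 2 - ([:2:] - P3)) b = 0" by (rule conjugate_root[OF n1 _ b_root])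
  hence eq: "ev P3 b * ev p b ^ 2 = 2 - ev P3 b" by (simp add: ev_simps)
  have "cnj ?a = ?a ^ (?N - 1)"
    using cnj_alpha_powi[of n 1] power_neg[OF a_root, of 1] by (simp add: power_int_minus)
  hence "ev (p - pcompose p (monom 1 (?N - 1))) ?a = 0"
    using real by (simp add: ev_simps p flip: ev_cnj)
  hence "ev (p - pcompose p (monom 1 (?N - 1))) b = 0" by (rule conjugate_root[OF n1 _ b_root])
  moreover have "cnj b = b ^ (?N - 1)"
    using cnj_alpha_powi[of n "int m"] power_neg[OF b_root, of 1]
    by (simp add: b_def power_int_minus)
  moreover have "cnj (ev p b) = ev p (cnj b)" by (simp only: ev_cnj)
  ultimately have "cnj (ev p b) = ev p b" by (simp add: ev_simps)
  then obtain r where r: "ev p b = complex_of_real r"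
    by (metis Reals_cases Reals_cnj_iff)
  define c where "c = 2 * cos (2 * pi / 2 ^ n)"
  have c1: "c > 1" unfolding c_def by (rule alpha_plus_inverse(2)[OF n])
  have "ev P3 b = complex_of_real (1 + c)"
    using alpha_plus_inverse(1)[OF n] by (simp add: P3[OF b_root] b3 c_def add.assoc)
  hence "complex_of_real ((1 + c) * r ^ 2) = complex_of_real (2 - (1 + c))"
    using eq by (simp add: r)
  hence "(1 + c) * r ^ 2 = 2 - (1 + c)" by (simp only: of_real_eq_iff)
  moreover have "(1 + c) * r ^ 2 \<ge> 0" using c1 by simp
  ultimately show False using c1 by linarith
qed

lemma q_notin_powers:
  assumes n: "n \<ge> 4"
  shows "q n 0 3 \<notin> powers (grp_D n) (2 ^ (n - 2))"
proof
  assume "q n 0 3 \<in> powers (grp_D n) (2 ^ (n - 2))"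
  then obtain x where x: "x \<in> grp_D n" "q n 0 3 = x ^ (2 ^ (n - 2))" by (auto simp: powers_def)
  have n1: "n \<ge> 1" using n by simp
  have "n - 2 = Suc (n - 3)" using n by simp
  hence "(2::nat) ^ (n - 2) = 2 ^ (n - 3) * 2" by simp
  hence "q n 0 3 = (x ^ (2 ^ (n - 3))) ^ 2" unfolding x(2) by (simp only: power_mult)
  moreover have "x ^ (2 ^ (n - 3)) \<in> grp_D n" by (rule subgroup_power[OF subgroup_D[OF n1] x(1)])
  ultimately show False
    using q_not_square[OF n D_in_Z_alpha[OF n1] cnj_D[OF n1]] by simp
qed

theorem mainTheorem4:
  fixes n :: nat
  assumes "n \<ge> 4"
  shows "subgroup_of (unit_grp n) (grp_F n) (grp_E n)
       \<and> proper_subgroup_of (unit_grp n) (powers (grp_D n) (2 ^ (n - 2))) (grp_F n)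
       \<and> subgroup_of (unit_grp n) (grp_F n) (grp_E n)
       \<and> proper_subgroup_of (unit_grp n) (grp_E n) (grp_D n)"
proof -
  have n1: "n \<ge> 1" using assms by simp
  note D = subgroup_D[OF n1] and E = subgroup_E[OF n1] and F = subgroup_F[OF assms]
  have "(2::int) ^ 3 \<le> 2 ^ (n - 1)" "(2::int) ^ 2 \<le> 2 ^ (n - 2)"
    using assms by (intro power_increasing; auto)+
  hence "d n 1 \<in> grp_D n" "3 \<in> factor_indices n 0"
    by (auto intro!: d_in_D simp: factor_indices_def idx_A_def)
  hence "grp_E n \<noteq> grp_D n" "q n 0 3 \<in> grp_F n"
    using d_1_notin_E[OF assms] q_power_in_F[OF assms, of 0 3] by auto
  moreover have "grp_E n \<subseteq> grp_D n" by (auto simp: grp_E_def)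
  ultimately show ?thesis
    unfolding proper_subgroup_of_def
    using subgroup_ofI[OF F E F_subset_E[OF assms]] subgroup_ofI[OF E D]
      subgroup_ofI[OF subgroup_powers[OF D] F D_powers_subset_F[OF assms]]
      q_notin_powers[OF assms] by auto
qed

end
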